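(* Let $n \in \mathbb{N}$ with $n > 1$, let $\lambda_1, \ldots, \lambda_n > 0$ with $\lambda_1 + \cdots + \lambda_n = 1$, let $a_1,\ldots,a_n \in \mathbb{R}$ and let $z$ be an integer with $1 \le z \le n-1$ such that $$a_1 < \cdots < a_z < \lambda_1 a_1 + \cdots + \lambda_n a_n < a_{z+1} < \cdots < a_n.$$ Then there are unique 1. $m \in \mathbb{N}$ such that $n/2 + |z - n/2| \le m \le n-1$, 2. $w_1,\ldots,w_m > 0$ with $w_1 + \cdots + w_m = 1$, 3. surjective functions $i : \{1,\ldots,m\} \to \{1,\ldots,z\}$, $s \mapsto i_s$, and $j : \{1,\ldots,m\} \to \{z+1,\ldots,n\}$, $s \mapsto j_s$, where $i_s$ is decreasing in $s$ and $j_s$ is increasing in $s$, such that $j_s - i_s$ is strictly increasing in $s$, 4. $p_s, q_s > 0$ with $p_s + q_s = 1$, $s = 1, \ldots, m$, such that $$(\lambda_1,\ldots,\lambda_n)^T = \sum_{s=1}^m w_s \left( p_s e_{i_s} + q_s e_{j_s} \right)$$ and $$p_s a_{i_s} + q_s a_{j_s} = \lambda_1 a_1 + \cdots + \lambda_n a_n, \quad s = 1,\ldots,m.$$ (Uniqueness is of the whole tuple consisting of $m$, the $w_s$, $i$, $j$ and the numbers $p_s, q_s$.)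
   Context: "Increasing" means nondecreasing and "decreasing" means nonincreasing. $e_k$ denotes the $k$-th standard basis column vector of $\mathbb{R}^n$. *)

theory Defs
  imports Complex_Main "HOL-Library.FuncSet"
begin

(* A vector of R^n is represented by its coordinate function on {1..n}; values outside
   {1..n} are never inspected.  std_basis k is the k-th standard basis vector. *)
definition std_basis :: "nat \<Rightarrow> nat \<Rightarrow> real" where
  "std_basis k = (\<lambda>l. if l = k then 1 else 0)"

end

theory Submission
  imports Defs
begin

text \<open>
  Write \<open>mu\<close> for the mean and \<open>dev k\<close> for the distance of \<open>a k\<close> to \<open>mu\<close>. A two-point distribution on
  \<open>k \<le> z < l\<close> has mean \<open>mu\<close> exactly if the first moments of its two atoms about \<open>mu\<close> balance, that is
  \<open>p * dev k = q * dev l\<close>; together with \<open>p + q = 1\<close> this determines \<open>p\<close> and \<open>q\<close>. The common value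
  \<open>v s = w s * p s * dev (i s) = w s * q s * dev (j s)\<close> is therefore the amount of first moment that
  component \<open>s\<close> transports from \<open>i s\<close> to \<open>j s\<close>, and it can be used in place of the weight \<open>w s\<close>. In
  these terms the representation of \<open>lam\<close> says that the \<open>v s\<close> form a transport plan, or coupling,
  between the moments \<open>lam k * dev k\<close> of the left points and those of the right points; the two
  totals agree because the deviations from the mean average to zero. The monotonicity conditions on
  \<open>i\<close> and \<open>j\<close> say that the plan is a staircase: it starts at the two points next to the mean and
  proceeds outwards on both sides without ever going back. So the theorem amounts to the existence
  and uniqueness of the monotone coupling of two finite sequences with the same sum (the north-west
  corner rule).

  That coupling is read off from partial sums. Put the partial sums of \<open>v\<close>, and those of the two
  sequences \<open>f\<close> and \<open>g\<close> of moments ordered outwards, as points on the same half-line. A row of the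
  staircase ends exactly where a partial sum of \<open>v\<close> meets one of \<open>f\<close>, a column exactly where it meets
  one of \<open>g\<close>, and strictness of the staircase means that every step ends a row or a column. Hence the
  partial sums of \<open>v\<close> are precisely the union of those of \<open>f\<close> and \<open>g\<close>
  (\<open>staircase_coupling_breakpoints\<close>). Since a strictly increasing enumeration of a finite set is
  unique, this determines the number of steps and \<open>v\<close>, and the row of step \<open>s\<close> is the \<open>k\<close> for which
  \<open>sum v {1..s}\<close> lies between the partial sums \<open>k - 1\<close> and \<open>k\<close> of \<open>f\<close>
  (\<open>staircase_coupling_unique\<close>). Conversely, enumerating the union and defining rows and columns in
  this way gives a staircase (\<open>staircase_coupling_exists\<close>).

  Finally \<open>m\<close> is at least \<open>z\<close> and \<open>n - z\<close>, whose maximum is \<open>n/2 + \<bar>z - n/2\<bar>\<close>, because \<open>i\<close> and \<open>j\<close> are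
  onto; it is at most \<open>n - 1\<close> because the strictly increasing \<open>j s - i s\<close> takes values between \<open>1\<close> and
  \<open>n - 1\<close>; and the \<open>w s\<close> sum to 1 because the \<open>lam k\<close> do.
\<close>

section \<open>Partial sums of positive sequences\<close>

lemma partial_sum_strict_mono:
  fixes v :: "nat \<Rightarrow> real"
  assumes "\<forall>s\<in>{1..m}. v s > 0"
  shows "strict_mono_on {0..m} (\<lambda>s. sum v {1..s})"
proof (rule strict_mono_onI)
  fix s u assume "s \<in> {0..m}" "u \<in> {0..m}" "s < u"
  then show "sum v {1..s} < sum v {1..u}"
    using assms by (intro sum_strict_mono2[where b = u]) (auto intro: less_imp_le)
qed

lemma partial_sum_less_iff:
  fixes v :: "nat \<Rightarrow> real"
  assumes "\<forall>s\<in>{1..m}. v s > 0" "s \<le> m" "u \<le> m"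
  shows "sum v {1..s} < sum v {1..u} \<longleftrightarrow> s < u"
  using strict_mono_on_less[OF partial_sum_strict_mono[OF assms(1)]] assms(2,3) by simp

lemma partial_sum_le_iff:
  fixes v :: "nat \<Rightarrow> real"
  assumes "\<forall>s\<in>{1..m}. v s > 0" "s \<le> m" "u \<le> m"
  shows "sum v {1..s} \<le> sum v {1..u} \<longleftrightarrow> s \<le> u"
  using partial_sum_less_iff[OF assms(1,3,2)] by linarith

text \<open>The partial sums are listed in strictly increasing order, and a finite set has only one such list.\<close>

lemma partial_sums_enumeration_unique:
  fixes v v' :: "nat \<Rightarrow> real"
  assumes pos: "\<forall>s\<in>{1..m}. v s > 0" and pos': "\<forall>s\<in>{1..m'}. v' s > 0"
    and eq: "(\<lambda>s. sum v {1..s}) ` {1..m} = (\<lambda>s. sum v' {1..s}) ` {1..m'}"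
  shows "m = m'" "\<forall>s\<in>{1..m}. v s = v' s"
proof -
  have sorted: "sorted_wrt (<) (map (\<lambda>s. sum u {1..s}) [1..<Suc k])"
    if "\<forall>s\<in>{1..k}. u s > 0" for u :: "nat \<Rightarrow> real" and k
    unfolding sorted_wrt_map
    by (rule sorted_wrt_mono_rel[OF _ sorted_wrt_upt]) (use partial_sum_less_iff[OF that] in auto)
  have "set (map (\<lambda>s. sum v' {1..s}) [1..<Suc m']) = set (map (\<lambda>s. sum v {1..s}) [1..<Suc m])"
    using eq by (simp add: atLeastLessThanSuc_atLeastAtMost del: upt_Suc)
  then have lists: "map (\<lambda>s. sum v' {1..s}) [1..<Suc m'] = map (\<lambda>s. sum v {1..s}) [1..<Suc m]"
    by (rule strict_sorted_equal[OF sorted[OF pos] sorted[OF pos']])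
  from arg_cong[OF this, of length] show m: "m = m'"
    by (simp del: upt_Suc)
  have partial: "sum v' {1..s} = sum v {1..s}" if "s \<le> m" for s
  proof (cases "s = 0")
    case False
    then show ?thesis
      using arg_cong[OF lists, of "\<lambda>l. l ! (s - 1)"] that m by (simp del: upt_Suc)
  qed simp
  show "\<forall>s\<in>{1..m}. v s = v' s"
  proof
    fix s assume s: "s \<in> {1..m}"
    then obtain u where "s = Suc u"
      by (cases s) auto
    then show "v s = v' s"
      using partial[of s] partial[of u] s by simp
  qed
qed

text \<open>The differences of consecutive elements of \<open>P\<close> do it; adding a new maximum \<open>b\<close> to \<open>P\<close> appends the
  difference between \<open>b\<close> and the previous total.\<close>

lemma partial_sums_enumeration_exists:
  fixes P :: "real set"
  assumes "finite P" "\<forall>c\<in>P. c > 0"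
  shows "\<exists>(m::nat) v. (\<forall>s\<in>{1..m}. v s > 0) \<and> (\<lambda>s. sum v {1..s}) ` {1..m} = P"
  using assms
proof (induction P rule: finite_linorder_max_induct)
  case empty
  show ?case
    by (rule exI[of _ 0]) simp
next
  case (insert b P)
  then obtain m :: nat and v :: "nat \<Rightarrow> real" where pos: "\<forall>s\<in>{1..m}. v s > 0"
    and P: "(\<lambda>s. sum v {1..s}) ` {1..m} = P"
    by auto
  have b: "sum v {1..m} < b"
  proof (cases "m = 0")
    case False
    then have "sum v {1..m} \<in> P"
      using P by auto
    then show ?thesis
      using insert.hyps by blast
  qed (use insert.prems in simp)
  define u where "u = v(Suc m := b - sum v {1..m})"
  have old: "sum u {1..s} = sum v {1..s}" if "s \<le> m" for s
    using that by (intro sum.cong) (auto simp: u_def)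
  have new: "sum u {1..Suc m} = b"
    using old[of m] by (simp add: u_def)
  have "(\<lambda>s. sum u {1..s}) ` {1..Suc m} = insert b ((\<lambda>s. sum u {1..s}) ` {1..m})"
    using new by (simp add: atLeastAtMostSuc_conv del: sum.cl_ivl_Suc)
  also have "(\<lambda>s. sum u {1..s}) ` {1..m} = P"
    unfolding P[symmetric] using old by (intro image_cong) auto
  finally have "(\<lambda>s. sum u {1..s}) ` {1..Suc m} = insert b P" .
  moreover have "\<forall>s\<in>{1..Suc m}. u s > 0"
    using pos b by (auto simp: u_def le_Suc_eq)
  ultimately show ?case
    by blast
qed

section \<open>Sums over consecutive blocks\<close>

text \<open>A nondecreasing surjection \<open>x\<close> cuts \<open>{1..m}\<close> into \<open>r\<close> consecutive blocks, and \<open>f k\<close> is the sum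
  of \<open>v\<close> over block \<open>k\<close>. A coupling has one such margin for its rows and one for its columns.\<close>

definition monotone_margin ::
    "nat \<Rightarrow> (nat \<Rightarrow> real) \<Rightarrow> nat \<Rightarrow> (nat \<Rightarrow> real) \<Rightarrow> (nat \<Rightarrow> nat) \<Rightarrow> bool" where
  "monotone_margin m v r f x \<longleftrightarrow> mono_on {1..m} x \<and> x ` {1..m} = {1..r} \<and>
     (\<forall>k\<in>{1..r}. sum v {s \<in> {1..m}. x s = k} = f k)"

lemma monotone_margin_sublevel_sum:
  assumes "monotone_margin m v r f x" "k \<le> r"
  shows "sum v {s \<in> {1..m}. x s \<le> k} = sum f {1..k}"
proof -
  let ?S = "{s \<in> {1..m}. x s \<le> k}"
  have range: "x ` {1..m} = {1..r}"
    using assms(1) by (simp add: monotone_margin_def)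
  have "sum v ?S = (\<Sum>l=1..k. sum v {s \<in> ?S. x s = l})"
    by (rule sum.group[symmetric]) (use range in auto)
  also have "\<dots> = (\<Sum>l=1..k. f l)"
  proof (rule sum.cong)
    fix l assume l: "l \<in> {1..k}"
    then have "{s \<in> ?S. x s = l} = {s \<in> {1..m}. x s = l}"
      by auto
    then show "sum v {s \<in> ?S. x s = l} = f l"
      using assms l by (simp add: monotone_margin_def)
  qed simp
  finally show ?thesis .
qed

text \<open>These bounds locate the block of \<open>s\<close> from partial sums alone: the first \<open>s\<close> positions contain all
  blocks before that of \<open>s\<close> and at least the element \<open>s\<close> more, and they stay within the blocks up to it.\<close>

lemma monotone_margin_bounds:
  assumes pos: "\<forall>s\<in>{1..m}. v s > 0" and marg: "monotone_margin m v r f x" and s: "s \<in> {1..m}"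
  shows "sum f {1..x s - 1} < sum v {1..s}" "sum v {1..s} \<le> sum f {1..x s}"
proof -
  have mono: "mono_on {1..m} x" and xs: "x s \<in> {1..r}"
    using marg s by (auto simp: monotone_margin_def)
  have "{u \<in> {1..m}. x u \<le> x s - 1} \<subseteq> {1..s} - {s}"
    using xs s mono_onD[OF mono, of s] by fastforce
  then have "sum v {u \<in> {1..m}. x u \<le> x s - 1} \<le> sum v ({1..s} - {s})"
    using pos s by (intro sum_mono2) (auto intro: less_imp_le)
  also have "\<dots> < sum v {1..s}"
    using pos s by (intro sum_strict_mono2[where b = s]) (auto intro: less_imp_le)
  finally show "sum f {1..x s - 1} < sum v {1..s}"
    using monotone_margin_sublevel_sum[OF marg, of "x s - 1"] xs by auto
  have "{1..s} \<subseteq> {u \<in> {1..m}. x u \<le> x s}"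
    using s mono_onD[OF mono, of _ s] by auto
  then have "sum v {1..s} \<le> sum v {u \<in> {1..m}. x u \<le> x s}"
    using pos by (intro sum_mono2) (auto intro: less_imp_le)
  then show "sum v {1..s} \<le> sum f {1..x s}"
    using monotone_margin_sublevel_sum[OF marg, of "x s"] xs by auto
qed

text \<open>A position that is \<open>m\<close> or is followed by a jump is the last one of its block, so the first \<open>s\<close>
  positions consist of complete blocks.\<close>

lemma monotone_margin_jump:
  assumes marg: "monotone_margin m v r f x" and s: "s \<in> {1..m}"
    and jump: "Suc s \<le> m \<Longrightarrow> x s < x (Suc s)"
  shows "sum v {1..s} = sum f {1..x s}"
proof -
  have mono: "mono_on {1..m} x" and xs: "x s \<in> {1..r}"
    using marg s by (auto simp: monotone_margin_def)
  have "u \<le> s" if "u \<in> {1..m}" "x u \<le> x s" for u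
  proof (rule ccontr)
    assume "\<not> u \<le> s"
    then have "x (Suc s) \<le> x u"
      using that(1) by (intro mono_onD[OF mono]) auto
    then show False
      using jump that \<open>\<not> u \<le> s\<close> by simp
  qed
  moreover have "x u \<le> x s" if "u \<in> {1..s}" for u
    using that s by (intro mono_onD[OF mono]) auto
  ultimately have "{u \<in> {1..m}. x u \<le> x s} = {1..s}"
    using s by force
  then show ?thesis
    using monotone_margin_sublevel_sum[OF marg, of "x s"] xs by simp
qed

lemma monotone_margin_breakpoints:
  assumes marg: "monotone_margin m v r f x"
  shows "(\<lambda>k. sum f {1..k}) ` {1..r} \<subseteq> (\<lambda>s. sum v {1..s}) ` {1..m}"
proof clarify
  fix k assume k: "k \<in> {1..r}"
  have mono: "mono_on {1..m} x" and range: "x ` {1..m} = {1..r}"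
    using marg by (auto simp: monotone_margin_def)
  define s where "s = Max {s \<in> {1..m}. x s = k}"
  have "k \<in> x ` {1..m}"
    unfolding range by (rule k)
  then have "{s \<in> {1..m}. x s = k} \<noteq> {}"
    by auto
  then have s: "s \<in> {1..m}" "x s = k" and max: "\<And>u. u \<in> {1..m} \<Longrightarrow> x u = k \<Longrightarrow> u \<le> s"
    using Max_in[of "{s \<in> {1..m}. x s = k}"] by (auto simp: s_def)
  have "x s < x (Suc s)" if "Suc s \<le> m"
    using mono_onD[OF mono, of s "Suc s"] max[of "Suc s"] s that by force
  then have "sum v {1..s} = sum f {1..k}"
    using monotone_margin_jump[OF marg s(1)] s(2) by simp
  then show "sum f {1..k} \<in> (\<lambda>s. sum v {1..s}) ` {1..m}"
    using s(1) by (metis imageI)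
qed

text \<open>The half-open intervals between consecutive partial sums of \<open>f\<close> are disjoint, and \<open>x s\<close> is the index
  of the one that contains the partial sum of \<open>v\<close> at \<open>s\<close>.\<close>

lemma monotone_margin_unique:
  assumes pos: "\<forall>s\<in>{1..m}. v s > 0" and posf: "\<forall>k\<in>{1..r}. f k > 0"
    and marg: "monotone_margin m v r f x" and marg': "monotone_margin m v r f x'"
    and s: "s \<in> {1..m}"
  shows "x s = x' s"
proof -
  have le: "y s \<le> y' s" if "monotone_margin m v r f y" "monotone_margin m v r f y'" for y y'
  proof -
    have ys: "y s \<in> {1..r}" "y' s \<in> {1..r}"
      using that s by (auto simp: monotone_margin_def)
    have "sum f {1..y s - 1} < sum f {1..y' s}"
      using monotone_margin_bounds(1)[OF pos that(1) s] monotone_margin_bounds(2)[OF pos that(2) s]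
      by linarith
    then have "y s - 1 < y' s"
      by (subst (asm) partial_sum_less_iff[OF posf]) (use ys in auto)
    then show ?thesis
      by simp
  qed
  show ?thesis
    using le[OF marg marg'] le[OF marg' marg] by simp
qed

text \<open>Assigning to \<open>s\<close> the interval between partial sums of \<open>f\<close> that contains \<open>sum v {1..s}\<close> gives blocks
  with the right sums, because every partial sum of \<open>f\<close> is also one of \<open>v\<close>, so that no \<open>v s\<close> is split
  between two blocks. The last conclusion, a jump of \<open>x\<close> after every partial sum of \<open>f\<close>, later
  makes the staircase strict.\<close>

lemma monotone_margin_exists:
  fixes v f :: "nat \<Rightarrow> real"
  assumes pos: "\<forall>s\<in>{1..m}. v s > 0" and posf: "\<forall>k\<in>{1..r}. f k > 0"
    and breaks: "(\<lambda>k. sum f {1..k}) ` {1..r} \<subseteq> (\<lambda>s. sum v {1..s}) ` {1..m}"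
    and total: "sum v {1..m} = sum f {1..r}"
  shows "\<exists>x. monotone_margin m v r f x \<and>
    (\<forall>s u. s \<in> {1..m} \<longrightarrow> u \<in> {1..m} \<longrightarrow> s < u \<longrightarrow>
       sum v {1..s} \<in> (\<lambda>k. sum f {1..k}) ` {1..r} \<longrightarrow> x s < x u)"
proof -
  define x where "x s = (LEAST k. sum v {1..s} \<le> sum f {1..k})" for s
  have sublevel: "x s \<le> k \<longleftrightarrow> sum v {1..s} \<le> sum f {1..k}" if s: "s \<in> {1..m}" and k: "k \<le> r" for s k
  proof
    assume "sum v {1..s} \<le> sum f {1..k}"
    then show "x s \<le> k"
      unfolding x_def by (rule Least_le)
  next
    assume "x s \<le> k"
    have "sum v {1..s} \<le> sum f {1..r}"
      unfolding total[symmetric] using s by (subst partial_sum_le_iff[OF pos]) auto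
    then have "sum v {1..s} \<le> sum f {1..x s}"
      unfolding x_def by (rule LeastI)
    also have "\<dots> \<le> sum f {1..k}"
      using \<open>x s \<le> k\<close> k by (subst partial_sum_le_iff[OF posf]) auto
    finally show "sum v {1..s} \<le> sum f {1..k}" .
  qed
  have range: "x s \<in> {1..r}" if s: "s \<in> {1..m}" for s
  proof -
    have "sum v {1..s} > sum v {1..0}"
      using s by (subst partial_sum_less_iff[OF pos]) auto
    then have "\<not> x s \<le> 0"
      using sublevel[OF s, of 0] by simp
    moreover have "x s \<le> r"
      unfolding sublevel[OF s order_refl] total[symmetric]
      using s by (subst partial_sum_le_iff[OF pos]) auto
    ultimately show ?thesis
      by simp
  qed
  have mono: "mono_on {1..m} x"
  proof (rule mono_onI)
    fix s u assume su: "s \<in> {1..m}" "u \<in> {1..m}" "s \<le> u"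
    have "sum v {1..s} \<le> sum v {1..u}"
      using su by (subst partial_sum_le_iff[OF pos]) auto
    also have "\<dots> \<le> sum f {1..x u}"
      using sublevel[OF su(2), of "x u"] range[OF su(2)] by simp
    finally show "x s \<le> x u"
      using sublevel[OF su(1), of "x u"] range[OF su(2)] by simp
  qed
  have at_break: "x s = k" if s: "s \<in> {1..m}" and k: "k \<in> {1..r}"
    and eq: "sum v {1..s} = sum f {1..k}" for s k
  proof (rule antisym)
    show "x s \<le> k"
      using sublevel[OF s, of k] k eq by simp
    show "k \<le> x s"
      using sublevel[OF s, of "x s"] range[OF s] k partial_sum_le_iff[OF posf, of k "x s"] eq
      by simp
  qed
  have break_attained: thesis
    if "k \<in> {1..r}" and "\<And>s. s \<in> {1..m} \<Longrightarrow> sum v {1..s} = sum f {1..k} \<Longrightarrow> thesis" for k thesis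
  proof -
    have "sum f {1..k} \<in> (\<lambda>s. sum v {1..s}) ` {1..m}"
      using breaks that(1) by (rule subsetD[OF _ imageI])
    then show thesis
      by (rule imageE) (rule that(2), simp_all)
  qed
  have surj: "x ` {1..m} = {1..r}"
  proof
    show "{1..r} \<subseteq> x ` {1..m}"
    proof
      fix k assume k: "k \<in> {1..r}"
      then obtain s where "s \<in> {1..m}" "sum v {1..s} = sum f {1..k}"
        by (rule break_attained)
      then show "k \<in> x ` {1..m}"
        using at_break[of s k] k by blast
    qed
  qed (use range in blast)
  have level: "sum v {s \<in> {1..m}. x s \<le> k} = sum f {1..k}" if k: "k \<le> r" for k
  proof (cases "k = 0")
    case True
    then have "{s \<in> {1..m}. x s \<le> k} = {}"
      using range by fastforce
    then show ?thesis
      using True by (simp only: sum.empty) simp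
  next
    case False
    with k have "k \<in> {1..r}"
      by simp
    then obtain s where s: "s \<in> {1..m}" and eq: "sum v {1..s} = sum f {1..k}"
      by (rule break_attained)
    have "x u \<le> k \<longleftrightarrow> u \<le> s" if u: "u \<in> {1..m}" for u
      unfolding sublevel[OF u k] eq[symmetric] using u s by (subst partial_sum_le_iff[OF pos]) auto
    then have "{u \<in> {1..m}. x u \<le> k} = {1..s}"
      using s by auto
    then show ?thesis
      using eq by simp
  qed
  have "sum v {s \<in> {1..m}. x s = k} = f k" if k: "k \<in> {1..r}" for k
  proof -
    obtain l where l: "k = Suc l"
      using k by (cases k) auto
    have "{s \<in> {1..m}. x s \<le> k} = {s \<in> {1..m}. x s \<le> l} \<union> {s \<in> {1..m}. x s = k}"
      using l by auto
    then have "sum v {s \<in> {1..m}. x s \<le> k} =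
        sum v {s \<in> {1..m}. x s \<le> l} + sum v {s \<in> {1..m}. x s = k}"
      using l by (simp only:) (rule sum.union_disjoint, auto)
    then show ?thesis
      using level[of k] level[of l] k l by simp
  qed
  then have "monotone_margin m v r f x"
    using mono surj by (simp add: monotone_margin_def)
  moreover have "x s < x u" if s: "s \<in> {1..m}" and u: "u \<in> {1..m}" and "s < u"
    and breakpoint: "sum v {1..s} \<in> (\<lambda>k. sum f {1..k}) ` {1..r}" for s u
  proof -
    obtain k where k: "k \<in> {1..r}" "sum v {1..s} = sum f {1..k}"
      using breakpoint by auto
    have "\<not> sum v {1..u} \<le> sum v {1..s}"
      using s u \<open>s < u\<close> by (subst partial_sum_le_iff[OF pos]) auto
    then have "\<not> x u \<le> k"
      using sublevel[OF u, of k] k by simp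
    then show ?thesis
      using at_break[OF s k] by simp
  qed
  ultimately show ?thesis
    by blast
qed

section \<open>The monotone coupling\<close>

text \<open>The cells \<open>(x s, y s)\<close> are the support of a matrix with entries \<open>v s\<close>, row sums \<open>f\<close> and column
  sums \<open>g\<close>. Given that \<open>x\<close> and \<open>y\<close> are nondecreasing, strictness of the sum says that consecutive cells
  are distinct.\<close>

definition staircase_coupling ::
    "nat \<Rightarrow> (nat \<Rightarrow> real) \<Rightarrow> nat \<Rightarrow> (nat \<Rightarrow> real) \<Rightarrow>
     nat \<Rightarrow> (nat \<Rightarrow> real) \<Rightarrow> (nat \<Rightarrow> nat) \<Rightarrow> (nat \<Rightarrow> nat) \<Rightarrow> bool" where
  "staircase_coupling r f t g m v x y \<longleftrightarrow>
     (\<forall>s\<in>{1..m}. v s > 0) \<and> monotone_margin m v r f x \<and> monotone_margin m v t g y \<and>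
     strict_mono_on {1..m} (\<lambda>s. x s + y s)"

text \<open>A step that ended neither a row nor a column would leave both \<open>x\<close> and \<open>y\<close> unchanged, against
  strictness.\<close>

lemma staircase_coupling_breakpoints:
  assumes "staircase_coupling r f t g m v x y"
  shows "(\<lambda>s. sum v {1..s}) ` {1..m} =
    (\<lambda>k. sum f {1..k}) ` {1..r} \<union> (\<lambda>k. sum g {1..k}) ` {1..t}" (is "?V = ?F \<union> ?G")
proof
  have marg: "monotone_margin m v r f x" "monotone_margin m v t g y"
    and strict: "strict_mono_on {1..m} (\<lambda>s. x s + y s)"
    using assms by (auto simp: staircase_coupling_def)
  show "?F \<union> ?G \<subseteq> ?V"
    using marg[THEN monotone_margin_breakpoints] by blast
  show "?V \<subseteq> ?F \<union> ?G"
  proof clarify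
    fix s assume s: "s \<in> {1..m}" and G: "sum v {1..s} \<notin> ?G"
    have xs: "x s \<in> {1..r}" and ys: "y s \<in> {1..t}"
      using marg s by (auto simp: monotone_margin_def)
    have "sum v {1..s} \<noteq> sum g {1..y s}"
      using G ys by blast
    then have "Suc s \<le> m" "\<not> y s < y (Suc s)"
      using monotone_margin_jump[OF marg(2) s] by auto
    then have "x s < x (Suc s)"
      using strict_mono_onD[OF strict, of s "Suc s"] s by auto
    then show "sum v {1..s} \<in> ?F"
      using monotone_margin_jump[OF marg(1) s] xs by auto
  qed
qed

proposition staircase_coupling_unique:
  assumes "\<forall>k\<in>{1..r}. f k > 0" "\<forall>k\<in>{1..t}. g k > 0"
    and c: "staircase_coupling r f t g m v x y" and c': "staircase_coupling r f t g m' v' x' y'"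
  shows "m = m'" "\<forall>s\<in>{1..m}. v s = v' s \<and> x s = x' s \<and> y s = y' s"
proof -
  have pos: "\<forall>s\<in>{1..m}. v s > 0" and pos': "\<forall>s\<in>{1..m'}. v' s > 0"
    using c c' by (auto simp: staircase_coupling_def)
  have breaks: "(\<lambda>s. sum v {1..s}) ` {1..m} = (\<lambda>s. sum v' {1..s}) ` {1..m'}"
    using staircase_coupling_breakpoints[OF c] staircase_coupling_breakpoints[OF c'] by simp
  show m: "m = m'"
    by (rule partial_sums_enumeration_unique[OF pos pos' breaks])
  have v: "\<forall>s\<in>{1..m}. v s = v' s"
    by (rule partial_sums_enumeration_unique[OF pos pos' breaks])
  have "monotone_margin m v k h u \<longleftrightarrow> monotone_margin m v' k h u" for k h u
  proof -
    have "sum v {s \<in> {1..m}. u s = l} = sum v' {s \<in> {1..m}. u s = l}" for l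
      using v by (intro sum.cong) auto
    then show ?thesis
      by (simp add: monotone_margin_def)
  qed
  then show "\<forall>s\<in>{1..m}. v s = v' s \<and> x s = x' s \<and> y s = y' s"
    using c c' m v monotone_margin_unique[OF pos assms(1), of x x']
      monotone_margin_unique[OF pos assms(2), of y y']
    by (simp add: staircase_coupling_def)
qed

text \<open>The increments of the union of the partial sums of \<open>f\<close> and \<open>g\<close> serve as \<open>v\<close>. Each step ends at a
  partial sum of \<open>f\<close> or of \<open>g\<close>, so \<open>x\<close> or \<open>y\<close> increases after it.\<close>

proposition staircase_coupling_exists:
  assumes posf: "\<forall>k\<in>{1..r}. f k > 0" and posg: "\<forall>k\<in>{1..t}. g k > 0"
    and total: "sum f {1..r} = sum g {1..t}" and r: "1 \<le> r"
  shows "\<exists>m v x y. staircase_coupling r f t g m v x y"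
proof -
  let ?F = "(\<lambda>k. sum f {1..k}) ` {1..r}" and ?G = "(\<lambda>k. sum g {1..k}) ` {1..t}"
  have pos_le: "\<forall>c\<in>?F. 0 < c \<and> c \<le> sum f {1..r}" "\<forall>c\<in>?G. 0 < c \<and> c \<le> sum g {1..t}"
    using partial_sum_less_iff[OF posf, of 0] partial_sum_le_iff[OF posf, of _ r]
      partial_sum_less_iff[OF posg, of 0] partial_sum_le_iff[OF posg, of _ t] by auto
  then have "finite (?F \<union> ?G)" "\<forall>c\<in>?F \<union> ?G. c > 0"
    by (auto simp only: finite_Un finite_imageI finite_atLeastAtMost ball_Un)
  then obtain m and v :: "nat \<Rightarrow> real" where pos: "\<forall>s\<in>{1..m}. v s > 0"
    and V: "(\<lambda>s. sum v {1..s}) ` {1..m} = ?F \<union> ?G"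
    by (metis partial_sums_enumeration_exists)
  \<comment> \<open>The common total of \<open>f\<close> and \<open>g\<close> is the largest breakpoint, hence the total of \<open>v\<close>.\<close>
  have "sum f {1..r} \<in> (\<lambda>s. sum v {1..s}) ` {1..m}"
    unfolding V using r by auto
  then obtain s where s: "s \<in> {1..m}" and eq: "sum f {1..r} = sum v {1..s}"
    by auto
  have "sum v {1..m} \<in> ?F \<union> ?G"
    unfolding V[symmetric] using s by auto
  then have "sum v {1..m} \<le> sum f {1..r}"
    using pos_le total by auto
  moreover have "sum f {1..r} \<le> sum v {1..m}"
    unfolding eq using s by (subst partial_sum_le_iff[OF pos]) auto
  ultimately have vf: "sum v {1..m} = sum f {1..r}"
    by simp
  obtain x where x: "monotone_margin m v r f x"
    and jump_x: "\<And>s u. s \<in> {1..m} \<Longrightarrow> u \<in> {1..m} \<Longrightarrow> s < u \<Longrightarrow> sum v {1..s} \<in> ?F \<Longrightarrow> x s < x u"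
    using monotone_margin_exists[OF pos posf _ vf] V by auto
  obtain y where y: "monotone_margin m v t g y"
    and jump_y: "\<And>s u. s \<in> {1..m} \<Longrightarrow> u \<in> {1..m} \<Longrightarrow> s < u \<Longrightarrow> sum v {1..s} \<in> ?G \<Longrightarrow> y s < y u"
    using monotone_margin_exists[OF pos posg _ vf[unfolded total]] V by auto
  have "strict_mono_on {1..m} (\<lambda>s. x s + y s)"
  proof (rule strict_mono_onI)
    fix s u assume su: "s \<in> {1..m}" "u \<in> {1..m}" "s < u"
    have "mono_on {1..m} x" "mono_on {1..m} y"
      using x y by (simp_all add: monotone_margin_def)
    then have "x s \<le> x u" "y s \<le> y u"
      using su by (simp_all add: mono_onD)
    moreover have "sum v {1..s} \<in> ?F \<union> ?G"
      unfolding V[symmetric] using su by blast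
    ultimately show "x s + y s < x u + y u"
      using jump_x[OF su] jump_y[OF su] by fastforce
  qed
  then show ?thesis
    using pos x y by (auto simp: staircase_coupling_def)
qed

section \<open>Splittings into two-point distributions\<close>

text \<open>Since \<open>i\<close> and \<open>j\<close> have values on different sides of \<open>z\<close>, a coordinate is only met by one of them.\<close>

lemma sum_two_point_coordinate:
  fixes w p q :: "nat \<Rightarrow> real"
  assumes "\<forall>s\<in>{1..m}. i s \<le> z" "\<forall>s\<in>{1..m}. z < j s"
  shows "(\<Sum>s=1..m. w s * (p s * std_basis (i s) k + q s * std_basis (j s) k)) =
    (if k \<le> z then \<Sum>s | s \<in> {1..m} \<and> i s = k. w s * p s
     else \<Sum>s | s \<in> {1..m} \<and> j s = k. w s * q s)"
proof -
  have "w s * (p s * std_basis (i s) k + q s * std_basis (j s) k) =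
      (if k \<le> z then if i s = k then w s * p s else 0 else if j s = k then w s * q s else 0)"
    if "s \<in> {1..m}" for s
  proof -
    have "i s \<le> z" "z < j s"
      using assms that by auto
    then show ?thesis
      by (auto simp: std_basis_def)
  qed
  then have "(\<Sum>s=1..m. w s * (p s * std_basis (i s) k + q s * std_basis (j s) k)) =
    (\<Sum>s=1..m. if k \<le> z then if i s = k then w s * p s else 0 else if j s = k then w s * q s else 0)"
    by (rule sum.cong[OF refl])
  also have "\<dots> = (if k \<le> z then \<Sum>s | s \<in> {1..m} \<and> i s = k. w s * p s
     else \<Sum>s | s \<in> {1..m} \<and> j s = k. w s * q s)"
    using sum.inter_filter[of "{1..m}" "\<lambda>s. w s * p s" "\<lambda>s. i s = k"]
      sum.inter_filter[of "{1..m}" "\<lambda>s. w s * q s" "\<lambda>s. j s = k"] by simp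
  finally show ?thesis .
qed

locale split_distribution =
  fixes n z :: nat and lam a :: "nat \<Rightarrow> real" and mu :: real
  assumes z_pos: "1 \<le> z" and z_less: "z < n"
    and lam_pos: "\<And>k. k \<in> {1..n} \<Longrightarrow> lam k > 0"
    and lam_sum: "(\<Sum>k=1..n. lam k) = 1"
    and mean: "(\<Sum>k=1..n. lam k * a k) = mu"
    and left: "\<And>k. k \<in> {1..z} \<Longrightarrow> a k < mu"
    and right: "\<And>k. k \<in> {z+1..n} \<Longrightarrow> mu < a k"
begin

definition dev :: "nat \<Rightarrow> real" where
  "dev k = \<bar>a k - mu\<bar>"

lemma dev_left: "k \<in> {1..z} \<Longrightarrow> dev k = mu - a k"
  using left[of k] by (simp add: dev_def)

lemma dev_right: "k \<in> {z+1..n} \<Longrightarrow> dev k = a k - mu"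
  using right[of k] by (simp add: dev_def)

lemma dev_pos: "k \<in> {1..n} \<Longrightarrow> dev k > 0"
  using left[of k] right[of k] by (cases "k \<le> z") (auto simp: dev_def)

text \<open>Both sequences are indexed by the distance in rank from the gap around \<open>mu\<close>, so that the decreasing
  \<open>i\<close> and the increasing \<open>j\<close> both turn into nondecreasing functions.\<close>

definition left_moment :: "nat \<Rightarrow> real" where
  "left_moment l = lam (z + 1 - l) * dev (z + 1 - l)"

definition right_moment :: "nat \<Rightarrow> real" where
  "right_moment l = lam (z + l) * dev (z + l)"

lemma left_moment_pos: "\<forall>l\<in>{1..z}. left_moment l > 0"
  unfolding left_moment_def using z_less by (intro ballI mult_pos_pos lam_pos dev_pos) auto

lemma right_moment_pos: "\<forall>l\<in>{1..n - z}. right_moment l > 0"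
  unfolding right_moment_def by (intro ballI mult_pos_pos lam_pos dev_pos) auto

text \<open>The deviations from the mean average to zero.\<close>

lemma moments_balance: "sum left_moment {1..z} = sum right_moment {1..n - z}"
proof -
  have "(\<Sum>k=1..n. lam k * (a k - mu)) = (\<Sum>k=1..n. lam k * a k) - (\<Sum>k=1..n. lam k) * mu"
    by (simp add: right_diff_distrib sum_subtractf sum_distrib_right)
  then have zero: "(\<Sum>k=1..n. lam k * (a k - mu)) = 0"
    using lam_sum mean by simp
  have "{1..n} = {1..z} \<union> {z+1..n}"
    using z_less by auto
  then have split: "(\<Sum>k=1..z. lam k * (a k - mu)) + (\<Sum>k=z+1..n. lam k * (a k - mu)) = 0"
    unfolding zero[symmetric] by (simp only:) (rule sum.union_disjoint[symmetric], auto)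
  have "(\<Sum>k=1..z. lam k * (a k - mu)) = (\<Sum>l=1..z. - left_moment l)"
    by (rule sum.reindex_bij_witness[of _ "\<lambda>l. z + 1 - l" "\<lambda>k. z + 1 - k"])
      (auto simp: left_moment_def dev_left algebra_simps)
  moreover have "(\<Sum>k=z+1..n. lam k * (a k - mu)) = (\<Sum>l=1..n - z. right_moment l)"
    by (rule sum.reindex_bij_witness[of _ "\<lambda>l. z + l" "\<lambda>k. k - z"])
      (auto simp: right_moment_def dev_right)
  ultimately show ?thesis
    using split by (simp add: sum_negf)
qed

definition two_point_mixture ::
    "nat \<Rightarrow> (nat \<Rightarrow> real) \<Rightarrow> (nat \<Rightarrow> nat) \<Rightarrow> (nat \<Rightarrow> nat) \<Rightarrow> (nat \<Rightarrow> real) \<Rightarrow> (nat \<Rightarrow> real) \<Rightarrow> bool" where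
  "two_point_mixture m w i j p q \<longleftrightarrow>
      real n / 2 + \<bar>real z - real n / 2\<bar> \<le> real m \<and> m \<le> n - 1 \<and>
      w \<in> {1..m} \<rightarrow>\<^sub>E {0<..} \<and> (\<Sum>s=1..m. w s) = 1 \<and>
      i \<in> {1..m} \<rightarrow>\<^sub>E {1..z} \<and> i ` {1..m} = {1..z} \<and>
      j \<in> {1..m} \<rightarrow>\<^sub>E {z+1..n} \<and> j ` {1..m} = {z+1..n} \<and>
      antimono_on {1..m} i \<and> mono_on {1..m} j \<and>
      strict_mono_on {1..m} (\<lambda>s. int (j s) - int (i s)) \<and>
      p \<in> {1..m} \<rightarrow>\<^sub>E {0<..} \<and> q \<in> {1..m} \<rightarrow>\<^sub>E {0<..} \<and>
      (\<forall>s\<in>{1..m}. p s + q s = 1) \<and>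
      (\<forall>k\<in>{1..n}. lam k =
         (\<Sum>s=1..m. w s * (p s * std_basis (i s) k + q s * std_basis (j s) k))) \<and>
      (\<forall>s\<in>{1..m}. p s * a (i s) + q s * a (j s) = mu)"

lemma two_point_balance:
  assumes "k \<in> {1..z}" "l \<in> {z+1..n}" "p + q = 1"
  shows "p * a k + q * a l = mu \<longleftrightarrow> p * dev k = q * dev l"
proof -
  have "p * a k + q * a l - mu = p * (a k - mu) + q * (a l - mu)"
    using assms(3) by (simp add: algebra_simps flip: distrib_left)
  also have "\<dots> = q * dev l - p * dev k"
    using left[OF assms(1)] right[OF assms(2)] by (simp add: dev_def algebra_simps)
  finally show ?thesis
    by linarith
qed

lemma two_point_weights:
  assumes k: "k \<in> {1..z}" and l: "l \<in> {z+1..n}"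
  shows "p + q = 1 \<and> p * a k + q * a l = mu \<longleftrightarrow>
    p = dev l / (dev k + dev l) \<and> q = dev k / (dev k + dev l)"
proof -
  have pos: "dev k > 0" "dev l > 0"
    using dev_pos[of k] dev_pos[of l] k l z_less by auto
  have solve: "p + q = 1 \<and> p * dev k = q * dev l \<longleftrightarrow>
      p = dev l / (dev k + dev l) \<and> q = dev k / (dev k + dev l)"
  proof
    assume pq: "p + q = 1 \<and> p * dev k = q * dev l"
    then have q: "q = 1 - p"
      by simp
    show "p = dev l / (dev k + dev l) \<and> q = dev k / (dev k + dev l)"
      using pq pos unfolding q by (simp add: field_simps)
  next
    assume "p = dev l / (dev k + dev l) \<and> q = dev k / (dev k + dev l)"
    then show "p + q = 1 \<and> p * dev k = q * dev l"
      using pos by (simp add: add.commute flip: add_divide_distrib)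
  qed
  then show ?thesis
    using two_point_balance[OF k l, of p q] by blast
qed

text \<open>Multiplying coordinate \<open>k\<close> of the representation of \<open>lam\<close> by \<open>dev k\<close> turns it into the block sum for
  \<open>k\<close>, in the rows for \<open>k \<le> z\<close> and, by the balance of moments in each component, in the columns for
  \<open>k > z\<close>.\<close>

lemma mixture_imp_staircase:
  assumes mix: "two_point_mixture m w i j p q"
  shows "staircase_coupling z left_moment (n - z) right_moment m
    (\<lambda>s. w s * p s * dev (i s)) (\<lambda>s. z + 1 - i s) (\<lambda>s. j s - z)"
proof -
  let ?v = "\<lambda>s. w s * p s * dev (i s)"
  have "w \<in> {1..m} \<rightarrow>\<^sub>E {0<..}" "i \<in> {1..m} \<rightarrow>\<^sub>E {1..z}" "j \<in> {1..m} \<rightarrow>\<^sub>E {z+1..n}"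
      "p \<in> {1..m} \<rightarrow>\<^sub>E {0<..}" "q \<in> {1..m} \<rightarrow>\<^sub>E {0<..}"
    and i_onto: "i ` {1..m} = {1..z}" and j_onto: "j ` {1..m} = {z+1..n}"
    and anti: "antimono_on {1..m} i" and mono: "mono_on {1..m} j"
    and strict: "strict_mono_on {1..m} (\<lambda>s. int (j s) - int (i s))"
    and coord: "\<forall>k\<in>{1..n}. lam k =
      (\<Sum>s=1..m. w s * (p s * std_basis (i s) k + q s * std_basis (j s) k))"
    and bary: "\<forall>s\<in>{1..m}. p s + q s = 1" "\<forall>s\<in>{1..m}. p s * a (i s) + q s * a (j s) = mu"
    using mix unfolding two_point_mixture_def by simp_all
  note PiE = this(1-5)[THEN PiE_mem]
  have wpq: "w s > 0" "p s > 0" "p s + q s = 1" and i: "i s \<in> {1..z}" and j: "j s \<in> {z+1..n}"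
    and mu: "p s * a (i s) + q s * a (j s) = mu" if "s \<in> {1..m}" for s
    using PiE[OF that] bary that by simp_all
  have lam: "lam k = (if k \<le> z then \<Sum>s | s \<in> {1..m} \<and> i s = k. w s * p s
     else \<Sum>s | s \<in> {1..m} \<and> j s = k. w s * q s)" if "k \<in> {1..n}" for k
    unfolding bspec[OF coord that] by (rule sum_two_point_coordinate) (use i j in force)+
  have bal: "?v s = w s * q s * dev (j s)" if "s \<in> {1..m}" for s
    using two_point_balance[OF i[OF that] j[OF that]] wpq[OF that] mu[OF that] by simp
  have "\<forall>s\<in>{1..m}. ?v s > 0"
    using wpq dev_pos i z_less by force
  moreover have "monotone_margin m ?v z left_moment (\<lambda>s. z + 1 - i s)"
    unfolding monotone_margin_def
  proof (intro conjI ballI)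
    show "mono_on {1..m} (\<lambda>s. z + 1 - i s)"
      using monotone_onD[OF anti] by (intro mono_onI) (simp add: diff_le_mono2)
    have "(\<lambda>s. z + 1 - i s) ` {1..m} = (\<lambda>k. z + 1 - k) ` {1..z}"
      unfolding i_onto[symmetric] by (simp add: image_image)
    also have "\<dots> = {1..z}"
      by (rule bij_betw_imp_surj_on[OF bij_betw_byWitness[where f' = "\<lambda>k. z + 1 - k"]]) auto
    finally show "(\<lambda>s. z + 1 - i s) ` {1..m} = {1..z}" .
    fix k assume k: "k \<in> {1..z}"
    have "sum ?v {s \<in> {1..m}. z + 1 - i s = k} =
        (\<Sum>s | s \<in> {1..m} \<and> i s = z + 1 - k. w s * p s * dev (z + 1 - k))"
      using i k by (intro sum.cong) force+
    also have "\<dots> = left_moment k"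
    proof -
      have "z + 1 - k \<in> {1..n}" "z + 1 - k \<le> z"
        using k z_less by auto
      then show ?thesis
        using lam[of "z + 1 - k"] by (simp add: left_moment_def sum_distrib_right)
    qed
    finally show "sum ?v {s \<in> {1..m}. z + 1 - i s = k} = left_moment k" .
  qed
  moreover have "monotone_margin m ?v (n - z) right_moment (\<lambda>s. j s - z)"
    unfolding monotone_margin_def
  proof (intro conjI ballI)
    show "mono_on {1..m} (\<lambda>s. j s - z)"
      using mono_onD[OF mono] by (intro mono_onI) (simp add: diff_le_mono)
    have "(\<lambda>s. j s - z) ` {1..m} = (\<lambda>k. k - z) ` {z+1..n}"
      unfolding j_onto[symmetric] by (simp add: image_image)
    also have "\<dots> = {1..n - z}"
      by (rule bij_betw_imp_surj_on[OF bij_betw_byWitness[where f' = "\<lambda>k. z + k"]]) auto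
    finally show "(\<lambda>s. j s - z) ` {1..m} = {1..n - z}" .
    fix k assume k: "k \<in> {1..n - z}"
    have "sum ?v {s \<in> {1..m}. j s - z = k} =
        (\<Sum>s | s \<in> {1..m} \<and> j s = z + k. w s * q s * dev (z + k))"
      using j k bal by (intro sum.cong) force+
    also have "\<dots> = right_moment k"
    proof -
      have "z + k \<in> {1..n}" "\<not> z + k \<le> z"
        using k z_less by auto
      then show ?thesis
        using lam[of "z + k"] by (simp add: right_moment_def sum_distrib_right)
    qed
    finally show "sum ?v {s \<in> {1..m}. j s - z = k} = right_moment k" .
  qed
  moreover have "strict_mono_on {1..m} (\<lambda>s. (z + 1 - i s) + (j s - z))"
  proof (rule strict_mono_onI)
    fix s u assume su: "s \<in> {1..m}" "u \<in> {1..m}" "s < u"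
    show "(z + 1 - i s) + (j s - z) < (z + 1 - i u) + (j u - z)"
      using strict_mono_onD[OF strict su] i[OF su(1)] i[OF su(2)] j[OF su(1)] j[OF su(2)] by auto
  qed
  ultimately show ?thesis
    by (simp add: staircase_coupling_def)
qed

text \<open>The weights are forced: \<open>w s\<close> puts mass \<open>v s / dev (i s)\<close> on \<open>i s\<close> and mass \<open>v s / dev (j s)\<close> on
  \<open>j s\<close>, since moment is mass times deviation.\<close>

lemma staircase_imp_mixture:
  assumes stair: "staircase_coupling z left_moment (n - z) right_moment m v x y"
  shows "\<exists>w i j p q. two_point_mixture m w i j p q"
proof -
  define i where "i = (\<lambda>s\<in>{1..m}. z + 1 - x s)"
  define j where "j = (\<lambda>s\<in>{1..m}. z + y s)"
  define p where "p = (\<lambda>s\<in>{1..m}. dev (j s) / (dev (i s) + dev (j s)))"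
  define q where "q = (\<lambda>s\<in>{1..m}. dev (i s) / (dev (i s) + dev (j s)))"
  define w where "w = (\<lambda>s\<in>{1..m}. v s / dev (i s) + v s / dev (j s))"
  have v: "\<And>s. s \<in> {1..m} \<Longrightarrow> v s > 0" and mx: "monotone_margin m v z left_moment x"
    and my: "monotone_margin m v (n - z) right_moment y"
    and strict: "strict_mono_on {1..m} (\<lambda>s. x s + y s)"
    using stair by (auto simp: staircase_coupling_def)
  have x: "\<And>s. s \<in> {1..m} \<Longrightarrow> x s \<in> {1..z}" and y: "\<And>s. s \<in> {1..m} \<Longrightarrow> y s \<in> {1..n - z}"
    using mx my by (auto simp: monotone_margin_def)
  have i: "i s \<in> {1..z}" and j: "j s \<in> {z+1..n}" if "s \<in> {1..m}" for s
    using x[OF that] y[OF that] that z_less by (auto simp: i_def j_def)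
  have dev: "dev (i s) > 0" "dev (j s) > 0" if "s \<in> {1..m}" for s
    using i[OF that] j[OF that] z_less by (auto intro!: dev_pos)
  have wp: "w s * p s = v s / dev (i s)" and wq: "w s * q s = v s / dev (j s)" if "s \<in> {1..m}" for s
  proof -
    have "v s / dev (i s) + v s / dev (j s) =
        v s * (dev (i s) + dev (j s)) / (dev (i s) * dev (j s))"
      using dev[OF that] by (simp add: field_simps)
    moreover have "dev (i s) + dev (j s) \<noteq> 0"
      using dev[OF that] by linarith
    ultimately show "w s * p s = v s / dev (i s)" "w s * q s = v s / dev (j s)"
      using dev[OF that] that by (simp_all add: w_def p_def q_def)
  qed
  have pq: "p s + q s = 1 \<and> p s * a (i s) + q s * a (j s) = mu" if "s \<in> {1..m}" for s
    unfolding two_point_weights[OF i[OF that] j[OF that]] using that by (simp add: p_def q_def)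
  have i_onto: "i ` {1..m} = {1..z}"
  proof -
    have "i ` {1..m} = (\<lambda>k. z + 1 - k) ` x ` {1..m}"
      by (auto simp: i_def image_image)
    also have "\<dots> = (\<lambda>k. z + 1 - k) ` {1..z}"
      using mx by (simp add: monotone_margin_def)
    also have "\<dots> = {1..z}"
      by (rule bij_betw_imp_surj_on[OF bij_betw_byWitness[where f' = "\<lambda>k. z + 1 - k"]]) auto
    finally show ?thesis .
  qed
  have j_onto: "j ` {1..m} = {z+1..n}"
  proof -
    have "j ` {1..m} = (\<lambda>k. z + k) ` y ` {1..m}"
      by (auto simp: j_def image_image)
    also have "\<dots> = (\<lambda>k. z + k) ` {1..n - z}"
      using my by (simp add: monotone_margin_def)
    also have "\<dots> = {z+1..n}"
      using z_less by (simp add: image_add_atLeastAtMost)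
    finally show ?thesis .
  qed
  have coord: "lam k = (\<Sum>s=1..m. w s * (p s * std_basis (i s) k + q s * std_basis (j s) k))"
    if k: "k \<in> {1..n}" for k
  proof (cases "k \<le> z")
    case True
    have "(\<Sum>s | s \<in> {1..m} \<and> i s = k. w s * p s) = (\<Sum>s | s \<in> {1..m} \<and> i s = k. v s / dev k)"
      by (intro sum.cong) (auto simp: wp)
    also have "\<dots> = sum v {s \<in> {1..m}. x s = z + 1 - k} / dev k"
      unfolding sum_divide_distrib
      by (intro sum.cong) (use x True k in \<open>force simp: i_def\<close>)+
    also have "\<dots> = left_moment (z + 1 - k) / dev k"
    proof -
      have "z + 1 - k \<in> {1..z}"
        using True k by auto
      then show ?thesis
        using mx by (simp add: monotone_margin_def)
    qed
    also have "\<dots> = lam k"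
      using dev_pos[OF k] True by (simp add: left_moment_def)
    finally show ?thesis
      using True i j by (subst sum_two_point_coordinate[where z = z]) (simp_all add: Suc_le_eq)
  next
    case False
    have "(\<Sum>s | s \<in> {1..m} \<and> j s = k. w s * q s) = (\<Sum>s | s \<in> {1..m} \<and> j s = k. v s / dev k)"
      by (intro sum.cong) (auto simp: wq)
    also have "\<dots> = sum v {s \<in> {1..m}. y s = k - z} / dev k"
      unfolding sum_divide_distrib
      by (intro sum.cong) (use False in \<open>force simp: j_def\<close>)+
    also have "\<dots> = right_moment (k - z) / dev k"
    proof -
      have "k - z \<in> {1..n - z}"
        using False k by auto
      then show ?thesis
        using my by (simp add: monotone_margin_def)
    qed
    also have "\<dots> = lam k"
      using dev_pos[OF k] False by (simp add: right_moment_def)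
    finally show ?thesis
      using False i j by (subst sum_two_point_coordinate[where z = z]) (simp_all add: Suc_le_eq)
  qed
  \<comment> \<open>Each two-point distribution has total mass 1, so summing all coordinates of \<open>lam\<close> gives the sum of the weights.\<close>
  have w_sum: "(\<Sum>s=1..m. w s) = 1"
  proof -
    have "1 = (\<Sum>k=1..n. \<Sum>s=1..m. w s * (p s * std_basis (i s) k + q s * std_basis (j s) k))"
      unfolding lam_sum[symmetric] using coord by (intro sum.cong) auto
    also have "\<dots> = (\<Sum>s=1..m. \<Sum>k=1..n. w s * (p s * std_basis (i s) k + q s * std_basis (j s) k))"
      by (rule sum.swap)
    also have "\<dots> = (\<Sum>s=1..m. w s)"
    proof (rule sum.cong)
      fix s assume s: "s \<in> {1..m}"
      have one: "(\<Sum>k=1..n. std_basis l k) = 1" if "l \<in> {1..n}" for l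
        using that by (simp add: std_basis_def)
      have "(\<Sum>k=1..n. w s * (p s * std_basis (i s) k + q s * std_basis (j s) k)) =
          w s * (p s * (\<Sum>k=1..n. std_basis (i s) k) + q s * (\<Sum>k=1..n. std_basis (j s) k))"
        by (simp only: sum_distrib_left flip: sum.distrib)
      also have "\<dots> = w s"
        using one[of "i s"] one[of "j s"] i[OF s] j[OF s] pq[OF s] z_less by simp
      finally show "(\<Sum>k=1..n. w s * (p s * std_basis (i s) k + q s * std_basis (j s) k)) = w s" .
    qed simp
    finally show ?thesis
      by simp
  qed
  have strict': "strict_mono_on {1..m} (\<lambda>s. int (j s) - int (i s))"
  proof (rule strict_mono_onI)
    fix s u assume su: "s \<in> {1..m}" "u \<in> {1..m}" "s < u"
    show "int (j s) - int (i s) < int (j u) - int (i u)"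
      using strict_mono_onD[OF strict su] x[OF su(1)] x[OF su(2)] su by (simp add: i_def j_def)
  qed
  have "card {1..z} \<le> card {1..m}"
    unfolding i_onto[symmetric] by (rule card_image_le) simp
  moreover have "card {z+1..n} \<le> card {1..m}"
    unfolding j_onto[symmetric] by (rule card_image_le) simp
  ultimately have lower: "real n / 2 + \<bar>real z - real n / 2\<bar> \<le> real m"
    using z_less by simp
  have "card {1..m} \<le> card {1..int n - 1}"
  proof (rule card_inj_on_le)
    show "inj_on (\<lambda>s. int (j s) - int (i s)) {1..m}"
      by (rule strict_mono_on_imp_inj_on[OF strict'])
    show "(\<lambda>s. int (j s) - int (i s)) ` {1..m} \<subseteq> {1..int n - 1}"
      using i j by force
  qed simp
  then have upper: "m \<le> n - 1"
    by simp
  have anti: "antimono_on {1..m} i"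
    using mono_onD[of "{1..m}" x] mx
    by (intro monotone_onI) (simp add: i_def monotone_margin_def diff_le_mono2)
  have mono: "mono_on {1..m} j"
    using mono_onD[of "{1..m}" y] my by (intro mono_onI) (simp add: j_def monotone_margin_def)
  have "w \<in> {1..m} \<rightarrow>\<^sub>E {0<..}"
    using v dev by (auto simp: w_def intro!: add_pos_pos)
  moreover have "p \<in> {1..m} \<rightarrow>\<^sub>E {0<..}" "q \<in> {1..m} \<rightarrow>\<^sub>E {0<..}"
    using dev by (auto simp: p_def q_def intro!: divide_pos_pos add_pos_pos)
  moreover have "i \<in> {1..m} \<rightarrow>\<^sub>E {1..z}"
    using i by (simp add: PiE_iff) (simp add: i_def)
  moreover have "j \<in> {1..m} \<rightarrow>\<^sub>E {z+1..n}"
    using j by (simp add: PiE_iff) (simp add: j_def)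
  ultimately have "two_point_mixture m w i j p q"
    unfolding two_point_mixture_def
    using lower upper w_sum i_onto j_onto anti mono strict' coord pq by blast
  then show ?thesis
    by blast
qed

text \<open>The staircase gives \<open>i\<close> and \<open>j\<close>, these give \<open>p\<close> and \<open>q\<close> by \<open>two_point_weights\<close>, and then the
  transported moment gives \<open>w\<close>. Equality as functions uses that all of them are \<open>undefined\<close> outside
  \<open>{1..m}\<close>.\<close>

lemma mixture_unique:
  assumes mix: "two_point_mixture m w i j p q" and mix': "two_point_mixture m' w' i' j' p' q'"
  shows "m = m' \<and> w = w' \<and> i = i' \<and> j = j' \<and> p = p' \<and> q = q'"
proof -
  note unique = staircase_coupling_unique[OF left_moment_pos right_moment_pos
      mixture_imp_staircase[OF mix] mixture_imp_staircase[OF mix']]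
  have m: "m' = m"
    using unique(1) by simp
  have PiE: "w \<in> {1..m} \<rightarrow>\<^sub>E {0<..}" "i \<in> {1..m} \<rightarrow>\<^sub>E {1..z}" "j \<in> {1..m} \<rightarrow>\<^sub>E {z+1..n}"
      "p \<in> {1..m} \<rightarrow>\<^sub>E {0<..}" "q \<in> {1..m} \<rightarrow>\<^sub>E {0<..}"
    and bal: "\<forall>s\<in>{1..m}. p s + q s = 1 \<and> p s * a (i s) + q s * a (j s) = mu"
    using mix unfolding two_point_mixture_def by auto
  have PiE': "w' \<in> {1..m} \<rightarrow>\<^sub>E {0<..}" "i' \<in> {1..m} \<rightarrow>\<^sub>E {1..z}" "j' \<in> {1..m} \<rightarrow>\<^sub>E {z+1..n}"
      "p' \<in> {1..m} \<rightarrow>\<^sub>E {0<..}" "q' \<in> {1..m} \<rightarrow>\<^sub>E {0<..}"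
    and bal': "\<forall>s\<in>{1..m}. p' s + q' s = 1 \<and> p' s * a (i' s) + q' s * a (j' s) = mu"
    using mix' unfolding two_point_mixture_def m by auto
  have eq: "i s = i' s \<and> j s = j' s \<and> p s = p' s \<and> q s = q' s \<and> w s = w' s" if s: "s \<in> {1..m}" for s
  proof -
    have range: "i s \<in> {1..z}" "i' s \<in> {1..z}" "j s \<in> {z+1..n}" "j' s \<in> {z+1..n}"
      using PiE(2,3)[THEN PiE_mem, OF s] PiE'(2,3)[THEN PiE_mem, OF s] by auto
    have "z + 1 - i s = z + 1 - i' s" "j s - z = j' s - z"
      using unique(2) s by auto
    then have ij: "i s = i' s" "j s = j' s"
      using range by auto
    have pq: "p s = p' s" "q s = q' s"
      using bspec[OF bal s] bspec[OF bal' s] ij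
      unfolding two_point_weights[OF range(1,3)] two_point_weights[OF range(2,4)] by simp_all
    have "p s > 0" "dev (i s) > 0"
      using PiE_mem[OF PiE(4) s] range(1) dev_pos[of "i s"] z_less by auto
    moreover have "w s * p s * dev (i s) = w' s * p' s * dev (i' s)"
      using unique(2) s by auto
    ultimately have "w s = w' s"
      using ij pq by simp
    then show ?thesis
      using ij pq by simp
  qed
  have "w = w'" "i = i'" "j = j'" "p = p'" "q = q'"
    using eq by (auto intro!: PiE_ext[OF PiE(1) PiE'(1)] PiE_ext[OF PiE(2) PiE'(2)]
        PiE_ext[OF PiE(3) PiE'(3)] PiE_ext[OF PiE(4) PiE'(4)] PiE_ext[OF PiE(5) PiE'(5)])
  then show ?thesis
    using m by simp
qed

lemma mixture_exists: "\<exists>m w i j p q. two_point_mixture m w i j p q"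
proof -
  obtain m v x y where "staircase_coupling z left_moment (n - z) right_moment m v x y"
    using staircase_coupling_exists[OF left_moment_pos right_moment_pos moments_balance z_pos]
    by blast
  then show ?thesis
    using staircase_imp_mixture by blast
qed

end

theorem theorem2p4:
  fixes n z :: nat and lam a :: "nat \<Rightarrow> real"
  assumes "n > 1"
    and "\<forall>k\<in>{1..n}. lam k > 0" and "(\<Sum>k=1..n. lam k) = 1"
    and "1 \<le> z" and "z \<le> n - 1"
    and "strict_mono_on {1..z} a"
    and "a z < (\<Sum>k=1..n. lam k * a k)"
    and "(\<Sum>k=1..n. lam k * a k) < a (z + 1)"
    and "strict_mono_on {z+1..n} a"
  shows "\<exists>!(m :: nat, w :: nat \<Rightarrow> real, i :: nat \<Rightarrow> nat, j :: nat \<Rightarrow> nat,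
            p :: nat \<Rightarrow> real, q :: nat \<Rightarrow> real).
      real n / 2 + \<bar>real z - real n / 2\<bar> \<le> real m \<and> m \<le> n - 1 \<and>
      w \<in> {1..m} \<rightarrow>\<^sub>E {0<..} \<and> (\<Sum>s=1..m. w s) = 1 \<and>
      i \<in> {1..m} \<rightarrow>\<^sub>E {1..z} \<and> i ` {1..m} = {1..z} \<and>
      j \<in> {1..m} \<rightarrow>\<^sub>E {z+1..n} \<and> j ` {1..m} = {z+1..n} \<and>
      antimono_on {1..m} i \<and> mono_on {1..m} j \<and>
      strict_mono_on {1..m} (\<lambda>s. int (j s) - int (i s)) \<and>
      p \<in> {1..m} \<rightarrow>\<^sub>E {0<..} \<and> q \<in> {1..m} \<rightarrow>\<^sub>E {0<..} \<and>
      (\<forall>s\<in>{1..m}. p s + q s = 1) \<and>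
      (\<forall>k\<in>{1..n}. lam k =
         (\<Sum>s=1..m. w s * (p s * std_basis (i s) k + q s * std_basis (j s) k))) \<and>
      (\<forall>s\<in>{1..m}. p s * a (i s) + q s * a (j s) = (\<Sum>k=1..n. lam k * a k))"
proof -
  have left: "a k < (\<Sum>k=1..n. lam k * a k)" if "k \<in> {1..z}" for k
  proof -
    have "a k \<le> a z"
      using that by (intro strict_mono_on_leD[OF assms(6)]) auto
    then show ?thesis
      using assms(7) by linarith
  qed
  have right: "(\<Sum>k=1..n. lam k * a k) < a k" if "k \<in> {z+1..n}" for k
  proof -
    have "a (z + 1) \<le> a k"
      using that by (intro strict_mono_on_leD[OF assms(9)]) auto
    then show ?thesis
      using assms(8) by linarith
  qed
  interpret split_distribution n z lam a "\<Sum>k=1..n. lam k * a k"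
    by unfold_locales (use assms(1-5) left right in auto)
  obtain m w i j p q where "two_point_mixture m w i j p q"
    using mixture_exists by blast
  then have "\<exists>!(m, w, i, j, p, q). two_point_mixture m w i j p q"
    by (intro ex1I[of _ "(m, w, i, j, p, q)"]) (use mixture_unique in \<open>blast, clarify, blast\<close>)
  then show ?thesis
    unfolding two_point_mixture_def .
qed

end
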